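(* Let $0<a<1$ and $\theta_a(z,w)=\frac{zw-a}{1-azw}$ for $(z,w)\in\mathbb{D}^2$. Then the quotient module $\mathfrak{Q}_a=H^2(\mathbb{D}^2)\ominus\theta_aH^2(\mathbb{D}^2)$ is $\varphi$-doubly commuting.
   Context: $H^2(\mathbb{D}^2)$ is the Hardy space of the bidisc and $M_1,M_2$ are multiplication by the coordinates $z$ and $w$ on it. A quotient module is a closed subspace $\mathfrak{Q}$ invariant under $M_1^*$ and $M_2^*$; put $Q_i=P_{\mathfrak{Q}}M_i|_{\mathfrak{Q}}$, $i=1,2$, with $P_{\mathfrak Q}$ the orthogonal projection onto $\mathfrak{Q}$. $\mathfrak{Q}$ is $\varphi$-doubly commuting if $Q_1Q_2Q_2^*=Q_2^*Q_1Q_2$. $\ominus$ denotes orthogonal complement. *)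

theory Defs
  imports "HOL-Analysis.Analysis"
begin

definition bidisc :: "(complex \<times> complex) set" where
  "bidisc = ball 0 1 \<times> ball 0 1"

text \<open>\<open>H2_coeffs f c\<close>: on the bidisc, \<open>f\<close> is the sum of the power series with
  square-summable coefficients \<open>c\<close>. Such a \<open>c\<close> is uniquely determined by \<open>f\<close>.\<close>

definition H2_coeffs ::
    "(complex \<times> complex \<Rightarrow> complex) \<Rightarrow> (nat \<times> nat \<Rightarrow> complex) \<Rightarrow> bool" where
  "H2_coeffs f c \<longleftrightarrow>
     (\<lambda>k. (cmod (c k))\<^sup>2) summable_on UNIV \<and>
     (\<forall>(z, w) \<in> bidisc. ((\<lambda>(m, n). c (m, n) * z ^ m * w ^ n) has_sum f (z, w)) UNIV)"

text \<open>Functions on the bidisc are total functions vanishing off the bidisc, so that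
  equality in HOL is equality as functions on the bidisc.\<close>

definition H2 :: "(complex \<times> complex \<Rightarrow> complex) set" where
  "H2 = {f. (\<forall>p. p \<notin> bidisc \<longrightarrow> f p = 0) \<and> (\<exists>c. H2_coeffs f c)}"

definition H2_coeff :: "(complex \<times> complex \<Rightarrow> complex) \<Rightarrow> nat \<times> nat \<Rightarrow> complex" where
  "H2_coeff f = (THE c. H2_coeffs f c)"

definition H2_inner ::
    "(complex \<times> complex \<Rightarrow> complex) \<Rightarrow> (complex \<times> complex \<Rightarrow> complex) \<Rightarrow> complex" where
  "H2_inner f g = (\<Sum>\<^sub>\<infinity>k\<in>UNIV. H2_coeff f k * cnj (H2_coeff g k))"

definition H2_dist ::
    "(complex \<times> complex \<Rightarrow> complex) \<Rightarrow> (complex \<times> complex \<Rightarrow> complex) \<Rightarrow> real" where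
  "H2_dist f g = sqrt (Re (H2_inner (\<lambda>p. f p - g p) (\<lambda>p. f p - g p)))"

definition H2_closed_subspace :: "(complex \<times> complex \<Rightarrow> complex) set \<Rightarrow> bool" where
  "H2_closed_subspace S \<longleftrightarrow>
     S \<subseteq> H2 \<and> (\<lambda>p. 0) \<in> S \<and>
     (\<forall>f\<in>S. \<forall>g\<in>S. (\<lambda>p. f p + g p) \<in> S) \<and>
     (\<forall>\<alpha>. \<forall>f\<in>S. (\<lambda>p. \<alpha> * f p) \<in> S) \<and>
     closedin (Metric_space.mtopology H2 H2_dist) S"

definition H2_ominus :: "(complex \<times> complex \<Rightarrow> complex) set \<Rightarrow> (complex \<times> complex \<Rightarrow> complex) set" where
  "H2_ominus S = {f \<in> H2. \<forall>g\<in>S. H2_inner f g = 0}"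

text \<open>Orthogonal projection onto \<open>S\<close>, and adjoint of an operator \<open>T\<close> on the Hilbert
  space \<open>S\<close>; both are meaningful when \<open>S\<close> is a closed subspace of \<open>H2\<close> (and \<open>T\<close> is a
  bounded linear map of \<open>S\<close> into itself).\<close>

definition H2_proj ::
    "(complex \<times> complex \<Rightarrow> complex) set \<Rightarrow> (complex \<times> complex \<Rightarrow> complex) \<Rightarrow> complex \<times> complex \<Rightarrow> complex" where
  "H2_proj S f = (THE g. g \<in> S \<and> (\<forall>h\<in>S. H2_inner (\<lambda>p. f p - g p) h = 0))"

definition H2_adjoint ::
    "(complex \<times> complex \<Rightarrow> complex) set \<Rightarrow>
     ((complex \<times> complex \<Rightarrow> complex) \<Rightarrow> complex \<times> complex \<Rightarrow> complex) \<Rightarrow>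
     (complex \<times> complex \<Rightarrow> complex) \<Rightarrow> complex \<times> complex \<Rightarrow> complex" where
  "H2_adjoint S T g = (THE h. h \<in> S \<and> (\<forall>f\<in>S. H2_inner (T f) g = H2_inner f h))"

definition M1 :: "(complex \<times> complex \<Rightarrow> complex) \<Rightarrow> complex \<times> complex \<Rightarrow> complex" where
  "M1 f = (\<lambda>(z, w). z * f (z, w))"

definition M2 :: "(complex \<times> complex \<Rightarrow> complex) \<Rightarrow> complex \<times> complex \<Rightarrow> complex" where
  "M2 f = (\<lambda>(z, w). w * f (z, w))"

definition quotient_module :: "(complex \<times> complex \<Rightarrow> complex) set \<Rightarrow> bool" where
  "quotient_module Q \<longleftrightarrow>
     H2_closed_subspace Q \<and>
     (\<forall>f\<in>Q. H2_adjoint H2 M1 f \<in> Q) \<and> (\<forall>f\<in>Q. H2_adjoint H2 M2 f \<in> Q)"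

definition compression ::
    "(complex \<times> complex \<Rightarrow> complex) set \<Rightarrow>
     ((complex \<times> complex \<Rightarrow> complex) \<Rightarrow> complex \<times> complex \<Rightarrow> complex) \<Rightarrow>
     (complex \<times> complex \<Rightarrow> complex) \<Rightarrow> complex \<times> complex \<Rightarrow> complex" where
  "compression Q T f = H2_proj Q (T f)"

definition phi_doubly_commuting :: "(complex \<times> complex \<Rightarrow> complex) set \<Rightarrow> bool" where
  "phi_doubly_commuting Q \<longleftrightarrow>
     (let Q1 = compression Q M1; Q2 = compression Q M2; Q2' = H2_adjoint Q Q2
      in \<forall>f\<in>Q. Q1 (Q2 (Q2' f)) = Q2' (Q1 (Q2 f)))"

definition theta :: "real \<Rightarrow> complex \<times> complex \<Rightarrow> complex" where
  "theta a = (\<lambda>(z, w). (z * w - of_real a) / (1 - of_real a * z * w))"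

definition mult_H2 :: "(complex \<times> complex \<Rightarrow> complex) \<Rightarrow> (complex \<times> complex \<Rightarrow> complex) set" where
  "mult_H2 \<phi> = (\<lambda>f p. \<phi> p * f p) ` H2"

end

theory Submission
  imports Defs
begin

text \<open>
  Write \<open>\<theta>(z, w) = b(z w)\<close> with the Blaschke factor \<open>b(\<zeta>) = (\<zeta> - a) / (1 - a \<zeta>)\<close>.
  Multiplication by \<open>\<theta>\<close> preserves each diagonal \<open>m - n = k\<close> of the coefficient array and acts there
  as multiplication by \<open>b\<close> on the one-variable Hardy space, whose image has a one-dimensional
  complement, spanned by the kernel \<open>1 / (1 - a \<zeta>)\<close>. Hence the quotient module \<open>Q\<close> consists of the
  functions whose coefficients satisfy \<open>c(m + 1, n + 1) = a c(m, n)\<close> (\<open>H2_ominus_theta\<close>), and it has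
  an orthonormal basis \<open>(u\<^sub>k)\<close> indexed by the integers, with \<open>u\<^sub>k\<close> proportional to
  \<open>z\<^sup>k / (1 - a z w)\<close> for \<open>k \<ge> 0\<close> and to \<open>w\<^bsup>-k\<^esup> / (1 - a z w)\<close> for \<open>k \<le> 0\<close>.

  In this basis the compressions are bilateral weighted shifts. Here \<open>Q\<^sub>1 u\<^sub>k = \<mu>(k) u\<^bsub>k+1\<^esub>\<close> and
  \<open>Q\<^sub>2 u\<^sub>k = \<lambda>(k) u\<^bsub>k-1\<^esub>\<close>, where \<open>\<mu>(k)\<close> is \<open>1\<close> for \<open>k \<ge> 0\<close> and \<open>a\<close> for \<open>k < 0\<close>, and
  \<open>\<lambda>(k)\<close> is \<open>1\<close> for \<open>k \<le> 0\<close> and \<open>a\<close> for \<open>k > 0\<close>. So \<open>Q\<^sub>1 Q\<^sub>2 Q\<^sub>2\<^sup>*\<close> and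
  \<open>Q\<^sub>2\<^sup>* Q\<^sub>1 Q\<^sub>2\<close> map \<open>u\<^sub>k\<close> to \<open>\<mu>(k) \<lambda>(k+1)\<^sup>2 u\<^bsub>k+1\<^esub>\<close> and
  \<open>\<lambda>(k+1) \<mu>(k-1) \<lambda>(k) u\<^bsub>k+1\<^esub>\<close>, and these agree because \<open>\<mu>(k) \<lambda>(k+1) = a = \<mu>(k-1) \<lambda>(k)\<close>
  for every \<open>k\<close>.

  The formal argument works with coefficient arrays instead of the basis, so that no expansion in
  \<open>(u\<^sub>k)\<close> is needed. The compressed shifts have closed formulas on arrays (\<open>compression_M1\<close>,
  \<open>compression_M2\<close>), \<open>Q\<^sub>2\<^sup>*\<close> is the backward shift (\<open>adjoint_compression_M2\<close>), and the identity is
  checked entry by entry. That two arrays differ by an element orthogonal to \<open>Q\<close> is always seen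
  from a difference of the form \<open>S h - a h\<close>, with \<open>S\<close> the diagonal shift (\<open>Qseq_orthogonal\<close>).
\<close>

section \<open>Square-summable double sequences\<close>

definition l2 :: "(nat \<times> nat \<Rightarrow> complex) set" where
  "l2 = {c. (\<lambda>k. (cmod (c k))\<^sup>2) summable_on UNIV}"

definition l2_inner :: "(nat \<times> nat \<Rightarrow> complex) \<Rightarrow> (nat \<times> nat \<Rightarrow> complex) \<Rightarrow> complex" where
  "l2_inner c d = (\<Sum>\<^sub>\<infinity>k. c k * cnj (d k))"

lemma mult_summable_l2:
  assumes "c \<in> l2" "d \<in> l2"
  shows "(\<lambda>k. c k * d k) summable_on UNIV"
proof -
  have "(\<lambda>k. norm (c k * d k)) summable_on UNIV"
  proof (rule Infinite_Sum.abs_summable_product)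
    show "(\<lambda>k. norm (c k * c k)) summable_on UNIV" "(\<lambda>k. norm (d k * d k)) summable_on UNIV"
      using assms by (simp_all add: l2_def norm_mult power2_eq_square)
  qed
  then show ?thesis by (rule Infinite_Sum.abs_summable_summable)
qed

lemma l2_cnj: "c \<in> l2 \<Longrightarrow> (\<lambda>k. cnj (c k)) \<in> l2"
  by (simp add: l2_def)

lemma l2_inner_summable:
  "c \<in> l2 \<Longrightarrow> d \<in> l2 \<Longrightarrow> (\<lambda>k. c k * cnj (d k)) summable_on UNIV"
  using mult_summable_l2 l2_cnj by blast

lemma l2_zero: "(\<lambda>k. 0) \<in> l2"
  by (simp add: l2_def)

lemma l2_scale: "c \<in> l2 \<Longrightarrow> (\<lambda>k. \<alpha> * c k) \<in> l2"
  by (auto simp: l2_def norm_mult power_mult_distrib intro!: summable_on_cmult_right)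

lemma l2_add:
  assumes "c \<in> l2" "d \<in> l2"
  shows "(\<lambda>k. c k + d k) \<in> l2"
proof -
  have "(\<lambda>k. 2 * (cmod (c k))\<^sup>2 + 2 * (cmod (d k))\<^sup>2) summable_on UNIV"
    using assms by (intro summable_on_add summable_on_cmult_right) (auto simp: l2_def)
  then have "(\<lambda>k. (cmod (c k + d k))\<^sup>2) summable_on UNIV"
  proof (rule summable_on_comparison_test)
    fix k
    have "(cmod (c k + d k))\<^sup>2 \<le> (cmod (c k) + cmod (d k))\<^sup>2"
      by (intro power_mono norm_triangle_ineq) auto
    also have "\<dots> \<le> 2 * (cmod (c k))\<^sup>2 + 2 * (cmod (d k))\<^sup>2"
      using sum_squares_bound[of "cmod (c k)" "cmod (d k)"] by (simp add: power2_sum)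
    finally show "(cmod (c k + d k))\<^sup>2 \<le> 2 * (cmod (c k))\<^sup>2 + 2 * (cmod (d k))\<^sup>2" .
  qed auto
  then show ?thesis by (simp add: l2_def)
qed

lemma l2_diff: "c \<in> l2 \<Longrightarrow> d \<in> l2 \<Longrightarrow> (\<lambda>k. c k - d k) \<in> l2"
  using l2_add[of c "\<lambda>k. (-1) * d k"] l2_scale[of d "-1"] by simp

lemma l2_restrict:
  assumes "c \<in> l2"
  shows "(\<lambda>k. if P k then c k else 0) \<in> l2"
proof -
  have "(\<lambda>k. (cmod (if P k then c k else 0))\<^sup>2) summable_on UNIV"
    by (rule summable_on_comparison_test[of "\<lambda>k. (cmod (c k))\<^sup>2"]) (use assms in \<open>auto simp: l2_def\<close>)
  then show ?thesis by (simp add: l2_def)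
qed

lemma l2_inner_diff_left:
  "c \<in> l2 \<Longrightarrow> d \<in> l2 \<Longrightarrow> e \<in> l2 \<Longrightarrow> l2_inner (\<lambda>k. c k - d k) e = l2_inner c e - l2_inner d e"
proof -
  assume A: "c \<in> l2" "d \<in> l2" "e \<in> l2"
  have "l2_inner (\<lambda>k. c k - d k) e = (\<Sum>\<^sub>\<infinity>k. c k * cnj (e k) + - (d k * cnj (e k)))"
    unfolding l2_inner_def by (rule infsum_cong) (simp add: algebra_simps)
  also have "\<dots> = l2_inner c e - l2_inner d e"
    using A by (subst infsum_add) (simp_all add: l2_inner_def infsum_uminus l2_inner_summable summable_on_uminus)
  finally show ?thesis .
qed

lemma l2_inner_cnj: "cnj (l2_inner c d) = l2_inner d c"
proof -
  have "cnj (l2_inner c d) = (\<Sum>\<^sub>\<infinity>k. cnj (c k * cnj (d k)))"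
    unfolding l2_inner_def by (rule infsum_cnj[symmetric])
  also have "\<dots> = l2_inner d c"
    unfolding l2_inner_def by (rule infsum_cong) (simp add: mult.commute)
  finally show ?thesis .
qed

lemma l2_inner_diff_right:
  assumes "c \<in> l2" "d \<in> l2" "e \<in> l2"
  shows "l2_inner e (\<lambda>k. c k - d k) = l2_inner e c - l2_inner e d"
  using arg_cong[OF l2_inner_diff_left[OF assms], of cnj] by (simp add: l2_inner_cnj)

lemma l2_inner_scale_left: "l2_inner (\<lambda>k. \<alpha> * c k) d = \<alpha> * l2_inner c d"
proof -
  have "l2_inner (\<lambda>k. \<alpha> * c k) d = (\<Sum>\<^sub>\<infinity>k. \<alpha> * (c k * cnj (d k)))"
    unfolding l2_inner_def by (rule infsum_cong) (simp add: mult.assoc)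
  then show ?thesis unfolding l2_inner_def by (simp only: infsum_cmult_right')
qed

lemma l2_inner_scale_right: "l2_inner d (\<lambda>k. \<alpha> * c k) = cnj \<alpha> * l2_inner d c"
  using arg_cong[OF l2_inner_scale_left[of \<alpha> c d], of cnj] by (simp add: l2_inner_cnj)

lemma l2_inner_self: "l2_inner c c = of_real (\<Sum>\<^sub>\<infinity>k. (cmod (c k))\<^sup>2)"
proof -
  have "l2_inner c c = (\<Sum>\<^sub>\<infinity>k. of_real ((cmod (c k))\<^sup>2))"
    unfolding l2_inner_def by (rule infsum_cong) (simp only: complex_norm_square)
  also have "\<dots> = of_real (\<Sum>\<^sub>\<infinity>k. (cmod (c k))\<^sup>2)"
  proof (rule infsum_bounded_linear_strong)
    show "(\<lambda>k. complex_of_real ((cmod (c k))\<^sup>2)) summable_on UNIV \<longleftrightarrow>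
        (\<lambda>k. (cmod (c k))\<^sup>2) summable_on UNIV"
      using summable_on_Re[of "\<lambda>k. complex_of_real ((cmod (c k))\<^sup>2)" UNIV] summable_on_of_real
      by (auto simp del: of_real_power)
  qed (rule bounded_linear_of_real)
  finally show ?thesis .
qed

lemma l2_inner_self_zeroD:
  assumes "c \<in> l2" "l2_inner c c = 0"
  shows "c = (\<lambda>k. 0)"
proof
  fix k
  have "(cmod (c k))\<^sup>2 = 0"
    by (rule nonneg_infsum_le_0D[of "\<lambda>k. (cmod (c k))\<^sup>2" UNIV])
      (use assms in \<open>auto simp: l2_def l2_inner_self\<close>)
  then show "c k = 0" by simp
qed

definition l2_norm :: "(nat \<times> nat \<Rightarrow> complex) \<Rightarrow> real" where
  "l2_norm c = sqrt (\<Sum>\<^sub>\<infinity>k. (cmod (c k))\<^sup>2)"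

lemma L2_set_le_l2_norm:
  assumes "c \<in> l2" "finite F"
  shows "L2_set (\<lambda>k. cmod (c k)) F \<le> l2_norm c"
  unfolding L2_set_def l2_norm_def using assms
  by (intro real_sqrt_le_mono finite_sum_le_infsum) (auto simp: l2_def)

lemma cmod_le_l2_norm: "c \<in> l2 \<Longrightarrow> cmod (c k) \<le> l2_norm c"
  using L2_set_le_l2_norm[of c "{k}"] by simp

lemma l2_norm_triangle:
  assumes "c \<in> l2" "d \<in> l2"
  shows "l2_norm (\<lambda>k. c k + d k) \<le> l2_norm c + l2_norm d"
proof -
  have nn: "0 \<le> l2_norm c" "0 \<le> l2_norm d"
    by (auto simp: l2_norm_def intro!: infsum_nonneg)
  have "(\<Sum>\<^sub>\<infinity>k. (cmod (c k + d k))\<^sup>2) \<le> (l2_norm c + l2_norm d)\<^sup>2"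
  proof (rule infsum_le_finite_sums)
    show "(\<lambda>k. (cmod (c k + d k))\<^sup>2) summable_on UNIV"
      using l2_add[OF assms] by (simp add: l2_def)
  next
    fix F :: "(nat \<times> nat) set" assume F: "finite F"
    have "L2_set (\<lambda>k. cmod (c k + d k)) F \<le> L2_set (\<lambda>k. cmod (c k) + cmod (d k)) F"
      by (intro L2_set_mono norm_triangle_ineq) auto
    also have "\<dots> \<le> L2_set (\<lambda>k. cmod (c k)) F + L2_set (\<lambda>k. cmod (d k)) F"
      by (rule L2_set_triangle_ineq)
    also have "\<dots> \<le> l2_norm c + l2_norm d"
      using assms F by (intro add_mono L2_set_le_l2_norm)
    finally show "(\<Sum>k\<in>F. (cmod (c k + d k))\<^sup>2) \<le> (l2_norm c + l2_norm d)\<^sup>2"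
      unfolding L2_set_def by (rule sqrt_le_D)
  qed
  then have "l2_norm (\<lambda>k. c k + d k) \<le> sqrt ((l2_norm c + l2_norm d)\<^sup>2)"
    unfolding l2_norm_def[of "\<lambda>k. c k + d k"] by (rule real_sqrt_le_mono)
  then show ?thesis using nn by simp
qed

section \<open>Injective re-indexing\<close>

text \<open>The isometry of the sequence space that moves the entry at \<open>k\<close> to \<open>s k\<close> and fills the other
  places with \<open>0\<close>. Multiplication by \<open>z\<close>, \<open>w\<close> and \<open>z w\<close> are the instances of interest.\<close>

definition push :: "(nat \<times> nat \<Rightarrow> nat \<times> nat) \<Rightarrow> (nat \<times> nat \<Rightarrow> complex) \<Rightarrow> nat \<times> nat \<Rightarrow> complex" where
  "push s c k = (if k \<in> range s then c (inv s k) else 0)"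

lemma push_apply [simp]: "inj s \<Longrightarrow> push s c (s k) = c k"
  by (simp add: push_def)

lemma push_eq_0: "k \<notin> range s \<Longrightarrow> push s c k = 0"
  by (simp add: push_def)

lemma has_sum_range:
  assumes "inj s" "\<And>k. k \<notin> range s \<Longrightarrow> f k = 0"
  shows "(f has_sum x) UNIV \<longleftrightarrow> ((\<lambda>k. f (s k)) has_sum x) UNIV"
proof -
  have "(f has_sum x) UNIV \<longleftrightarrow> (f has_sum x) (range s)"
    by (rule has_sum_cong_neutral) (use assms in auto)
  then show ?thesis
    using has_sum_reindex[of s UNIV f x] assms(1) by (simp add: o_def)
qed

lemma summable_on_range:
  assumes "inj s" "\<And>k. k \<notin> range s \<Longrightarrow> f k = 0"
  shows "f summable_on UNIV \<longleftrightarrow> (\<lambda>k. f (s k)) summable_on UNIV"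
  unfolding summable_on_def using has_sum_range[OF assms] by simp

lemma push_l2: "inj s \<Longrightarrow> c \<in> l2 \<Longrightarrow> push s c \<in> l2"
  unfolding l2_def mem_Collect_eq
  by (subst summable_on_range[of s]) (auto simp: push_def)

lemma pull_l2:
  assumes "inj s" "c \<in> l2" shows "(\<lambda>k. c (s k)) \<in> l2"
proof -
  have "(\<lambda>k. (cmod (c k))\<^sup>2) summable_on range s"
    using assms by (auto simp: l2_def intro: summable_on_subset)
  then show ?thesis using assms by (simp add: summable_on_reindex l2_def o_def)
qed

text \<open>The adjoint of \<open>push s\<close> is composition with \<open>s\<close>; all adjoints below come from this.\<close>

lemma l2_inner_push: "inj s \<Longrightarrow> l2_inner (push s c) d = l2_inner c (\<lambda>k. d (s k))"
proof -
  assume s: "inj s"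
  have "\<And>x. ((\<lambda>k. push s c k * cnj (d k)) has_sum x) UNIV \<longleftrightarrow>
        ((\<lambda>k. c k * cnj (d (s k))) has_sum x) UNIV"
    by (subst has_sum_range[OF s]) (auto simp: push_def s)
  then show ?thesis unfolding l2_inner_def by (rule infsum_eqI')
qed

definition s1 :: "nat \<times> nat \<Rightarrow> nat \<times> nat" where "s1 k = (Suc (fst k), snd k)"
definition s2 :: "nat \<times> nat \<Rightarrow> nat \<times> nat" where "s2 k = (fst k, Suc (snd k))"
definition s12 :: "nat \<times> nat \<Rightarrow> nat \<times> nat" where "s12 k = (Suc (fst k), Suc (snd k))"

lemma s_Pair [simp]: "s1 (m, n) = (Suc m, n)" "s2 (m, n) = (m, Suc n)" "s12 (m, n) = (Suc m, Suc n)"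
  by (simp_all add: s1_def s2_def s12_def)

lemma inj_s1 [simp]: "inj s1" and inj_s2 [simp]: "inj s2" and inj_s12 [simp]: "inj s12"
  by (auto simp: inj_on_def)

lemma push_s1: "push s1 c (m, n) = (case m of 0 \<Rightarrow> 0 | Suc m' \<Rightarrow> c (m', n))"
proof (cases m)
  case (Suc m')
  then show ?thesis using push_apply[OF inj_s1, of c "(m', n)"] by simp
qed (auto intro!: push_eq_0)

lemma push_s2: "push s2 c (m, n) = (case n of 0 \<Rightarrow> 0 | Suc n' \<Rightarrow> c (m, n'))"
proof (cases n)
  case (Suc n')
  then show ?thesis using push_apply[OF inj_s2, of c "(m, n')"] by simp
qed (auto intro!: push_eq_0)

lemma push_s12:
  "push s12 c (m, n) = (case (m, n) of (Suc m', Suc n') \<Rightarrow> c (m', n') | _ \<Rightarrow> 0)"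
proof (cases "m = 0 \<or> n = 0")
  case False
  then obtain m' n' where "m = Suc m'" "n = Suc n'" by (metis not0_implies_Suc)
  then show ?thesis using push_apply[OF inj_s12, of c "(m', n')"] by simp
qed (auto intro!: push_eq_0 split: nat.splits)

section \<open>The coefficient isomorphism\<close>

definition mon :: "nat \<times> nat \<Rightarrow> complex \<times> complex \<Rightarrow> complex" where
  "mon k p = fst p ^ fst k * snd p ^ snd k"

lemma H2_coeffs_iff:
  "H2_coeffs f c \<longleftrightarrow> c \<in> l2 \<and> (\<forall>p\<in>bidisc. ((\<lambda>k. c k * mon k p) has_sum f p) UNIV)"
  by (auto simp: H2_coeffs_def l2_def mon_def case_prod_unfold mult.assoc)

text \<open>Up to conjugation, these are the coefficients of the reproducing kernel at \<open>p\<close>. They make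
  every power series with square-summable coefficients converge by Cauchy-Schwarz.\<close>

lemma mon_l2: "p \<in> bidisc \<Longrightarrow> (\<lambda>k. mon k p) \<in> l2"
proof -
  assume p: "p \<in> bidisc"
  have g: "(\<lambda>n. (cmod z ^ n)\<^sup>2) summable_on UNIV" if "cmod z < 1" for z
  proof -
    have "(cmod z)\<^sup>2 < 1" using that by (simp add: abs_square_less_1)
    then have "summable (\<lambda>n. ((cmod z)\<^sup>2) ^ n)" by (intro summable_geometric) auto
    then show ?thesis
      by (subst summable_on_UNIV_nonneg_real_iff) (auto simp: power_mult[symmetric] mult.commute)
  qed
  define A where "A = (\<lambda>n. (cmod (fst p) ^ n)\<^sup>2)"
  define B where "B = (\<lambda>n. (cmod (snd p) ^ n)\<^sup>2)"
  have AB: "A summable_on UNIV" "B summable_on UNIV"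
    using p unfolding A_def B_def by (auto simp: bidisc_def intro!: g)
  have "(\<lambda>k. A (fst k) * B (snd k)) summable_on UNIV \<times> UNIV"
  proof (rule summable_on_SigmaI)
    fix m :: nat
    show "((\<lambda>n. A (fst (m, n)) * B (snd (m, n))) has_sum (A m * infsum B UNIV)) UNIV"
      using has_sum_cmult_right[OF has_sum_infsum[OF AB(2)], of "A m"] by simp
    show "(\<lambda>m. A m * infsum B UNIV) summable_on UNIV"
      using AB(1) by (rule summable_on_cmult_left)
  qed (auto simp: A_def B_def)
  then show ?thesis
    by (simp add: l2_def mon_def norm_mult norm_power power_mult_distrib A_def B_def)
qed

lemma mon_summable: "c \<in> l2 \<Longrightarrow> p \<in> bidisc \<Longrightarrow> (\<lambda>k. c k * mon k p) summable_on UNIV"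
  using mult_summable_l2 mon_l2 by blast

text \<open>Once the lower coefficients vanish, dividing by \<open>z\<^sup>n\<close> leaves a power series with constant term
  \<open>b n\<close> that is zero off the origin; letting \<open>z\<close> tend to \<open>0\<close> gives \<open>b n = 0\<close>.\<close>

lemma powser_coeffs_zero:
  fixes b :: "nat \<Rightarrow> complex"
  assumes "\<And>z. cmod z < 1 \<Longrightarrow> ((\<lambda>n. b n * z ^ n) has_sum 0) UNIV"
  shows "b n = 0"
proof (induction n rule: less_induct)
  case (less n)
  have "((\<lambda>_. 0) \<longlongrightarrow> b (0 + n)) (at (0::complex))"
  proof (rule powser_limit_0_strong[of 1 "\<lambda>i. b (i + n)"])
    fix z :: complex assume z: "z \<noteq> 0" "norm z < 1"
    have "(\<lambda>i. b i * z ^ i) sums 0" using assms[OF z(2)] by (rule has_sum_imp_sums)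
    then have "(\<lambda>i. b (i + n) * z ^ (i + n)) sums 0"
      using less by (subst sums_iff_shift) auto
    then have "(\<lambda>i. b (i + n) * z ^ (i + n) * inverse (z ^ n)) sums (0 * inverse (z ^ n))"
      by (rule sums_mult2)
    then show "(\<lambda>i. b (i + n) * z ^ i) sums 0"
      using z by (simp add: power_add field_simps)
  qed auto
  then have "0 = b (0 + n)" by (intro tendsto_unique[of "at (0::complex)" "\<lambda>_. 0"]) auto
  then show ?case by simp
qed

text \<open>The one-variable case applies twice: first in \<open>z\<close> for fixed \<open>w\<close>, where the coefficients are the
  row sums, then in \<open>w\<close> to each row sum.\<close>

lemma mon_coeffs_zero:
  assumes "c \<in> l2" "\<And>p. p \<in> bidisc \<Longrightarrow> ((\<lambda>k. c k * mon k p) has_sum 0) UNIV"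
  shows "c = (\<lambda>k. 0)"
proof -
  have row: "(\<lambda>n. c (m, n) * w ^ n) summable_on UNIV" if w: "cmod w < 1" for m w
  proof -
    \<comment> \<open>any nonzero \<open>z\<close> in the disc serves to extract a row; \<open>z = 1/2\<close> is divided out again\<close>
    have "(\<lambda>(m, n). c (m, n) * mon (m, n) (1/2, w)) summable_on UNIV \<times> UNIV"
      using mon_summable[OF assms(1), of "(1/2, w)"] w
      by (simp add: case_prod_unfold bidisc_def norm_divide)
    from summable_on_SigmaD1[OF this, of m]
    have "(\<lambda>n. 2 ^ m * (c (m, n) * mon (m, n) (1/2, w))) summable_on UNIV"
      by (intro summable_on_cmult_right) auto
    then show ?thesis by (simp add: mon_def power_divide)
  qed
  have inner: "(\<Sum>\<^sub>\<infinity>n. c (m, n) * w ^ n) = 0" if w: "cmod w < 1" for m w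
  proof (rule powser_coeffs_zero)
    fix z :: complex assume z: "cmod z < 1"
    have "((\<lambda>k. c k * mon k (z, w)) has_sum 0) (UNIV \<times> UNIV)"
      using assms(2)[of "(z, w)"] z w by (simp add: bidisc_def)
    then show "((\<lambda>m. (\<Sum>\<^sub>\<infinity>n. c (m, n) * w ^ n) * z ^ m) has_sum 0) UNIV"
    proof (rule has_sum_SigmaD)
      fix m
      have "((\<lambda>n. c (m, n) * w ^ n * z ^ m) has_sum (\<Sum>\<^sub>\<infinity>n. c (m, n) * w ^ n) * z ^ m) UNIV"
        using row[OF w] by (intro has_sum_cmult_left has_sum_infsum)
      then show "((\<lambda>n. c (m, n) * mon (m, n) (z, w)) has_sum (\<Sum>\<^sub>\<infinity>n. c (m, n) * w ^ n) * z ^ m) UNIV"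
        by (simp add: mon_def mult_ac)
    qed
  qed
  have "c (m, n) = 0" for m n
  proof (rule powser_coeffs_zero)
    fix w :: complex assume w: "cmod w < 1"
    show "((\<lambda>n. c (m, n) * w ^ n) has_sum 0) UNIV"
      using has_sum_infsum[OF row[OF w]] inner[OF w] by simp
  qed
  then show ?thesis by auto
qed

lemma H2_coeffs_diff:
  "H2_coeffs f c \<Longrightarrow> H2_coeffs g d \<Longrightarrow> H2_coeffs (\<lambda>p. f p - g p) (\<lambda>k. c k - d k)"
proof -
  assume A: "H2_coeffs f c" "H2_coeffs g d"
  have "((\<lambda>k. c k * mon k p + - (d k * mon k p)) has_sum f p + - g p) UNIV" if "p \<in> bidisc" for p
    using A that by (intro has_sum_add has_sum_uminusI) (auto simp: H2_coeffs_iff)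
  then show ?thesis using A by (auto simp: H2_coeffs_iff l2_diff algebra_simps)
qed

lemma H2_coeffs_scale:
  "H2_coeffs f c \<Longrightarrow> H2_coeffs (\<lambda>p. \<alpha> * f p) (\<lambda>k. \<alpha> * c k)"
  by (auto simp: H2_coeffs_iff l2_scale mult.assoc intro!: has_sum_cmult_right)

lemma H2_coeffs_add:
  "H2_coeffs f c \<Longrightarrow> H2_coeffs g d \<Longrightarrow> H2_coeffs (\<lambda>p. f p + g p) (\<lambda>k. c k + d k)"
  using H2_coeffs_diff[of f c "\<lambda>p. (-1) * g p" "\<lambda>k. (-1) * d k"] H2_coeffs_scale[of g d "-1"] by simp

lemma H2_coeffs_push:
  assumes "inj s" "\<And>k p. mon (s k) p = u p * mon k p" "H2_coeffs f c"
  shows "H2_coeffs (\<lambda>p. u p * f p) (push s c)"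
  unfolding H2_coeffs_iff
proof (intro conjI ballI)
  show "push s c \<in> l2" using assms by (simp add: push_l2 H2_coeffs_iff)
  fix p assume p: "p \<in> bidisc"
  have "((\<lambda>k. u p * (c k * mon k p)) has_sum u p * f p) UNIV"
    using assms(3) p by (intro has_sum_cmult_right) (auto simp: H2_coeffs_iff)
  then show "((\<lambda>k. push s c k * mon k p) has_sum u p * f p) UNIV"
    by (subst has_sum_range[OF assms(1)]) (auto simp: push_def assms mult_ac)
qed

lemma H2_coeffs_unique:
  assumes "H2_coeffs f c" "H2_coeffs f d"
  shows "c = d"
proof -
  have "H2_coeffs (\<lambda>p. f p - f p) (\<lambda>k. c k - d k)" by (rule H2_coeffs_diff[OF assms])
  then have "(\<lambda>k. c k - d k) = (\<lambda>k. 0)" by (intro mon_coeffs_zero) (auto simp: H2_coeffs_iff)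
  then show ?thesis by (simp add: fun_eq_iff)
qed

lemma H2_coeff_eq: "H2_coeffs f c \<Longrightarrow> H2_coeff f = c"
  unfolding H2_coeff_def using H2_coeffs_unique by blast

lemma H2_inner_eq: "H2_coeffs f c \<Longrightarrow> H2_coeffs g d \<Longrightarrow> H2_inner f g = l2_inner c d"
  by (simp add: H2_inner_def l2_inner_def H2_coeff_eq)

text \<open>The inverse of the coefficient map. The value \<open>0\<close> off the bidisc matches the convention in
  \<open>H2\<close>, so that \<open>H2_fun\<close> is a bijection from \<open>l2\<close> onto \<open>H2\<close>.\<close>

definition H2_fun :: "(nat \<times> nat \<Rightarrow> complex) \<Rightarrow> complex \<times> complex \<Rightarrow> complex" where
  "H2_fun c p = (if p \<in> bidisc then \<Sum>\<^sub>\<infinity>k. c k * mon k p else 0)"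

lemma H2_coeffs_H2_fun: "c \<in> l2 \<Longrightarrow> H2_coeffs (H2_fun c) c"
  by (auto simp: H2_coeffs_iff H2_fun_def mon_summable)

lemma H2_fun_outside: "p \<notin> bidisc \<Longrightarrow> H2_fun c p = 0"
  by (simp add: H2_fun_def)

lemma H2_fun_in_H2: "c \<in> l2 \<Longrightarrow> H2_fun c \<in> H2"
  using H2_coeffs_H2_fun by (auto simp: H2_def H2_fun_def)

lemma H2_fun_eqI: "H2_coeffs f c \<Longrightarrow> (\<And>p. p \<notin> bidisc \<Longrightarrow> f p = 0) \<Longrightarrow> f = H2_fun c"
  by (auto simp: H2_fun_def H2_coeffs_iff fun_eq_iff infsumI)

lemma H2_eq_image: "H2 = H2_fun ` l2"
proof
  show "H2 \<subseteq> H2_fun ` l2"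
    by (auto simp: H2_def intro!: image_eqI[OF H2_fun_eqI]) (auto simp: H2_coeffs_iff)
qed (auto simp: H2_fun_in_H2)

lemma H2_fun_add: "c \<in> l2 \<Longrightarrow> d \<in> l2 \<Longrightarrow> (\<lambda>p. H2_fun c p + H2_fun d p) = H2_fun (\<lambda>k. c k + d k)"
  by (rule H2_fun_eqI) (simp_all add: H2_coeffs_add H2_coeffs_H2_fun H2_fun_outside)

lemma H2_fun_scale: "c \<in> l2 \<Longrightarrow> (\<lambda>p. \<alpha> * H2_fun c p) = H2_fun (\<lambda>k. \<alpha> * c k)"
  by (rule H2_fun_eqI) (simp_all add: H2_coeffs_scale H2_coeffs_H2_fun H2_fun_outside)

lemma H2_fun_diff: "c \<in> l2 \<Longrightarrow> d \<in> l2 \<Longrightarrow> (\<lambda>p. H2_fun c p - H2_fun d p) = H2_fun (\<lambda>k. c k - d k)"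
  by (rule H2_fun_eqI) (simp_all add: H2_coeffs_diff H2_coeffs_H2_fun H2_fun_outside)

lemma H2_inner_H2_fun: "c \<in> l2 \<Longrightarrow> d \<in> l2 \<Longrightarrow> H2_inner (H2_fun c) (H2_fun d) = l2_inner c d"
  by (simp add: H2_inner_eq H2_coeffs_H2_fun)

lemma M1_H2_fun: "c \<in> l2 \<Longrightarrow> M1 (H2_fun c) = H2_fun (push s1 c)"
proof (rule H2_fun_eqI)
  assume "c \<in> l2"
  then have "H2_coeffs (\<lambda>p. fst p * H2_fun c p) (push s1 c)"
    by (intro H2_coeffs_push inj_s1 H2_coeffs_H2_fun) (auto simp: mon_def s1_def)
  then show "H2_coeffs (M1 (H2_fun c)) (push s1 c)"
    by (simp add: M1_def case_prod_unfold)
qed (auto simp: M1_def H2_fun_def)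

lemma M2_H2_fun: "c \<in> l2 \<Longrightarrow> M2 (H2_fun c) = H2_fun (push s2 c)"
proof (rule H2_fun_eqI)
  assume "c \<in> l2"
  then have "H2_coeffs (\<lambda>p. snd p * H2_fun c p) (push s2 c)"
    by (intro H2_coeffs_push inj_s2 H2_coeffs_H2_fun) (auto simp: mon_def s2_def)
  then show "H2_coeffs (M2 (H2_fun c)) (push s2 c)"
    by (simp add: M2_def case_prod_unfold)
qed (auto simp: M2_def H2_fun_def)

lemma H2_dist_H2_fun:
  "c \<in> l2 \<Longrightarrow> d \<in> l2 \<Longrightarrow> H2_dist (H2_fun c) (H2_fun d) = l2_norm (\<lambda>k. c k - d k)"
  by (simp add: H2_dist_def H2_fun_diff H2_inner_H2_fun l2_diff l2_inner_self l2_norm_def)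

text \<open>Nonnegativity and symmetry of a metric are required of all functions, also outside \<open>H2\<close>. If
  \<open>f - g\<close> has no coefficients, then neither has \<open>g - f\<close>, and both distances are computed from the
  same unspecified array.\<close>

lemma Metric_space_H2: "Metric_space H2 H2_dist"
proof
  fix f g :: "complex \<times> complex \<Rightarrow> complex"
  show "0 \<le> H2_dist f g"
    by (simp add: H2_dist_def H2_inner_def l2_inner_def[symmetric] l2_inner_self infsum_nonneg)
  show "H2_dist f g = H2_dist g f"
  proof -
    define F where "F = (\<lambda>p. f p - g p)"
    have G: "(\<lambda>p. g p - f p) = (\<lambda>p. (-1) * F p)" by (simp add: F_def)
    show ?thesis
    proof (cases "\<exists>c. H2_coeffs F c")
      case True
      then obtain c where c: "H2_coeffs F c" by blast
      have "H2_inner F F = l2_inner c c" by (rule H2_inner_eq[OF c c])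
      moreover have "H2_inner (\<lambda>p. (-1) * F p) (\<lambda>p. (-1) * F p) = l2_inner (\<lambda>k. (-1) * c k) (\<lambda>k. (-1) * c k)"
        by (intro H2_inner_eq H2_coeffs_scale c)
      ultimately show ?thesis unfolding H2_dist_def G F_def[symmetric]
        by (simp add: l2_inner_self)
    next
      case False
      have "\<nexists>c. H2_coeffs (\<lambda>p. (-1) * F p) c"
        using False H2_coeffs_scale[of "\<lambda>p. (-1) * F p" _ "-1"] by auto
      with False have "H2_coeff (\<lambda>p. (-1) * F p) = H2_coeff F"
        by (simp add: H2_coeff_def)
      then show ?thesis unfolding H2_dist_def G F_def[symmetric] H2_inner_def by simp
    qed
  qed
next
  fix f g assume "f \<in> H2" "g \<in> H2"
  then obtain c d where cd: "c \<in> l2" "d \<in> l2" "f = H2_fun c" "g = H2_fun d"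
    by (auto simp: H2_eq_image)
  have "c = d" if "l2_norm (\<lambda>k. c k - d k) = 0"
    using cmod_le_l2_norm[OF l2_diff[OF cd(1,2)]] that by (auto simp: fun_eq_iff)
  then have "l2_norm (\<lambda>k. c k - d k) = 0 \<longleftrightarrow> c = d"
    by (auto simp: l2_norm_def)
  moreover have "H2_fun c = H2_fun d \<longleftrightarrow> c = d"
    using H2_coeffs_unique[OF H2_coeffs_H2_fun[OF cd(1)], of d] H2_coeffs_H2_fun[OF cd(2)] by auto
  ultimately show "H2_dist f g = 0 \<longleftrightarrow> f = g"
    using cd by (simp add: H2_dist_H2_fun)
next
  fix f g h assume "f \<in> H2" "g \<in> H2" "h \<in> H2"
  then obtain c d e where cd: "c \<in> l2" "d \<in> l2" "e \<in> l2" "f = H2_fun c" "g = H2_fun d" "h = H2_fun e"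
    by (auto simp: H2_eq_image)
  show "H2_dist f h \<le> H2_dist f g + H2_dist g h"
    using l2_norm_triangle[OF l2_diff[OF cd(1,2)] l2_diff[OF cd(2,3)]] cd by (simp add: H2_dist_H2_fun)
qed

text \<open>Two candidates for the adjoint differ by an element of \<open>S\<close> that is orthogonal to itself.\<close>

lemma H2_adjoint_eqI:
  assumes S: "S = H2_fun ` L" "L \<subseteq> l2" "\<And>c d. c \<in> L \<Longrightarrow> d \<in> L \<Longrightarrow> (\<lambda>k. c k - d k) \<in> L"
    and h: "h \<in> L" "\<And>c. c \<in> L \<Longrightarrow> H2_inner (T (H2_fun c)) g = l2_inner c h"
  shows "H2_adjoint S T g = H2_fun h"
  unfolding H2_adjoint_def
proof (rule the_equality)
  show "H2_fun h \<in> S \<and> (\<forall>f\<in>S. H2_inner (T f) g = H2_inner f (H2_fun h))"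
    using S h by (auto simp: H2_inner_H2_fun subset_iff)
next
  fix h' assume A: "h' \<in> S \<and> (\<forall>f\<in>S. H2_inner (T f) g = H2_inner f h')"
  then obtain e where e: "e \<in> L" "h' = H2_fun e" using S by auto
  let ?d = "\<lambda>k. e k - h k"
  have d: "?d \<in> L" using S(3) e h by blast
  then have "l2_inner ?d h = H2_inner (T (H2_fun ?d)) g" using h by simp
  also have "\<dots> = H2_inner (H2_fun ?d) h'" using A d S by blast
  also have "\<dots> = l2_inner ?d e" using d e S(2) by (simp add: H2_inner_H2_fun subset_iff)
  finally have "l2_inner ?d ?d = 0" using d e h S(2) by (simp add: l2_inner_diff_right subset_iff)
  then have "?d = (\<lambda>k. 0)" using d S(2) by (intro l2_inner_self_zeroD) auto
  then have "e = h" by (simp add: fun_eq_iff)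
  then show "h' = H2_fun h" using e by simp
qed

text \<open>As for adjoints, the difference of two candidates is an element of \<open>S\<close> orthogonal to itself.\<close>

lemma H2_proj_eqI:
  assumes S: "S = H2_fun ` L" "L \<subseteq> l2" "\<And>c d. c \<in> L \<Longrightarrow> d \<in> L \<Longrightarrow> (\<lambda>k. c k - d k) \<in> L"
    and c: "c \<in> l2" and h: "h \<in> L" "\<And>d. d \<in> L \<Longrightarrow> l2_inner (\<lambda>k. c k - h k) d = 0"
  shows "H2_proj S (H2_fun c) = H2_fun h"
  unfolding H2_proj_def
proof (rule the_equality)
  show "H2_fun h \<in> S \<and> (\<forall>d\<in>S. H2_inner (\<lambda>p. H2_fun c p - H2_fun h p) d = 0)"
    using S h c by (auto simp: H2_fun_diff l2_diff H2_inner_H2_fun subset_iff)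
next
  fix h' assume A: "h' \<in> S \<and> (\<forall>d\<in>S. H2_inner (\<lambda>p. H2_fun c p - h' p) d = 0)"
  then obtain e where e: "e \<in> L" "h' = H2_fun e" using S by auto
  let ?d = "\<lambda>k. e k - h k"
  have d: "?d \<in> L" using S(3) e h by blast
  have l: "e \<in> l2" "h \<in> l2" "?d \<in> l2" using e h d S(2) by auto
  have "l2_inner (\<lambda>k. c k - e k) ?d = H2_inner (\<lambda>p. H2_fun c p - h' p) (H2_fun ?d)"
    using l c e by (simp add: H2_fun_diff H2_inner_H2_fun l2_diff)
  also have "\<dots> = 0" using A d S by blast
  finally have "l2_inner ?d ?d = 0" using h(2)[OF d] l c by (simp add: l2_inner_diff_left)
  then have "?d = (\<lambda>k. 0)" using l by (intro l2_inner_self_zeroD) auto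
  then have "e = h" by (simp add: fun_eq_iff)
  then show "h' = H2_fun h" using e by simp
qed

lemma H2_adjoint_M1: "c \<in> l2 \<Longrightarrow> H2_adjoint H2 M1 (H2_fun c) = H2_fun (\<lambda>k. c (s1 k))"
  by (rule H2_adjoint_eqI[OF H2_eq_image])
    (simp_all add: l2_diff pull_l2[OF inj_s1] M1_H2_fun H2_inner_H2_fun push_l2[OF inj_s1] l2_inner_push[OF inj_s1])

lemma H2_adjoint_M2: "c \<in> l2 \<Longrightarrow> H2_adjoint H2 M2 (H2_fun c) = H2_fun (\<lambda>k. c (s2 k))"
  by (rule H2_adjoint_eqI[OF H2_eq_image])
    (simp_all add: l2_diff pull_l2[OF inj_s2] M2_H2_fun H2_inner_H2_fun push_l2[OF inj_s2] l2_inner_push[OF inj_s2])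

section \<open>The quotient module\<close>

text \<open>The coefficient arrays of the quotient module: on every diagonal they are geometric with ratio
  \<open>a\<close>, hence they form the eigenspace of the backward diagonal shift for \<open>a\<close>.\<close>

definition Qseq :: "real \<Rightarrow> (nat \<times> nat \<Rightarrow> complex) set" where
  "Qseq a = {c \<in> l2. \<forall>k. c (s12 k) = of_real a * c k}"

lemma Qseq_l2: "Qseq a \<subseteq> l2" by (auto simp: Qseq_def)

lemma Qseq_s12: "c \<in> Qseq a \<Longrightarrow> c (s12 k) = of_real a * c k"
  unfolding Qseq_def by blast

lemma Qseq_Suc: "c \<in> Qseq a \<Longrightarrow> c (Suc m, Suc n) = of_real a * c (m, n)"
  using Qseq_s12[of c a "(m, n)"] by simp

lemma Qseq_diff: "c \<in> Qseq a \<Longrightarrow> d \<in> Qseq a \<Longrightarrow> (\<lambda>k. c k - d k) \<in> Qseq a"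
  by (auto simp: Qseq_def l2_diff algebra_simps)

text \<open>Moving \<open>S - a\<close> to the other side of the inner product gives \<open>S\<^sup>* - a\<close>, which vanishes on
  \<open>Qseq a\<close>.\<close>

lemma Qseq_orthogonal:
  assumes "h \<in> l2" "c \<in> Qseq a"
  shows "l2_inner (\<lambda>k. push s12 h k - of_real a * h k) c = 0"
proof -
  have c: "c \<in> l2" "(\<lambda>k. c (s12 k)) = (\<lambda>k. of_real a * c k)" using assms by (auto simp: Qseq_def)
  have "l2_inner (\<lambda>k. push s12 h k - of_real a * h k) c = l2_inner h (\<lambda>k. c (s12 k)) - of_real a * l2_inner h c"
    using assms c(1) by (simp add: l2_inner_diff_left push_l2 inj_s12 l2_scale l2_inner_push l2_inner_scale_left)
  then show ?thesis by (simp add: c l2_inner_scale_right)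
qed

text \<open>Applied to \<open>g\<close>, this solves \<open>h - a S h = g\<close> along each diagonal: it gives the coefficients of
  \<open>g / (1 - a z w)\<close>.\<close>

fun resolvent :: "real \<Rightarrow> (nat \<times> nat \<Rightarrow> complex) \<Rightarrow> nat \<Rightarrow> nat \<Rightarrow> complex" where
  "resolvent a g (Suc m) (Suc n) = g (Suc m, Suc n) + of_real a * resolvent a g m n"
| "resolvent a g 0 n = g (0, n)"
| "resolvent a g m 0 = g (m, 0)"

text \<open>The point is square-summability of \<open>g / (1 - a z w)\<close>. Convexity of the square, applied to
  \<open>h = (1 - a) (g / (1 - a)) + a S h\<close>, bounds \<open>\<bar>h\<bar>\<^sup>2\<close> by \<open>\<bar>g\<bar>\<^sup>2 / (1 - a) + a \<bar>S h\<bar>\<^sup>2\<close>. Over a square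
  box the sum of \<open>\<bar>S h\<bar>\<^sup>2\<close> is at most that of \<open>\<bar>h\<bar>\<^sup>2\<close>, so it can be absorbed since \<open>a < 1\<close>.\<close>

lemma resolvent_exists:
  assumes a: "0 < a" "a < 1" and g: "g \<in> l2"
  obtains h where "h \<in> l2" "\<And>k. h k - of_real a * push s12 h k = g k"
proof
  define h where "h = (\<lambda>k. resolvent a g (fst k) (snd k))"
  show rec: "h k - of_real a * push s12 h k = g k" for k
  proof -
    obtain m n where "k = (m, n)" by (cases k)
    then show ?thesis by (cases m; cases n) (simp_all add: h_def push_s12)
  qed
  define G where "G = (\<Sum>\<^sub>\<infinity>k. (cmod (g k))\<^sup>2)"
  have pt: "(cmod (h k))\<^sup>2 \<le> (cmod (g k))\<^sup>2 / (1 - a) + a * (cmod (push s12 h k))\<^sup>2" for k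
  proof -
    let ?x = "cmod (g k)" and ?y = "cmod (push s12 h k)"
    have "h k = g k + of_real a * push s12 h k" using rec[of k] by (simp add: algebra_simps)
    then have "cmod (h k) \<le> ?x + a * ?y"
      using norm_triangle_ineq[of "g k" "of_real a * push s12 h k"] a by (simp add: norm_mult)
    then have "(cmod (h k))\<^sup>2 \<le> (?x + a * ?y)\<^sup>2" by (intro power_mono) auto
    also have "\<dots> \<le> ?x\<^sup>2 / (1 - a) + a * ?y\<^sup>2"
    proof -
      have "?x\<^sup>2 / (1 - a) + a * ?y\<^sup>2 - (?x + a * ?y)\<^sup>2 = a / (1 - a) * (?x - (1 - a) * ?y)\<^sup>2"
        using a by (simp add: field_simps power2_eq_square)
      moreover have "\<dots> \<ge> 0" using a by auto
      ultimately show ?thesis by linarith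
    qed
    finally show ?thesis .
  qed
  have box: "(\<Sum>k\<in>{..<N}\<times>{..<N}. (cmod (h k))\<^sup>2) \<le> G / (1 - a)\<^sup>2" for N
  proof -
    let ?B = "{..<N}\<times>{..<N}" and ?H = "\<Sum>k\<in>{..<N}\<times>{..<N}. (cmod (h k))\<^sup>2"
    have "(\<Sum>k\<in>?B. (cmod (push s12 h k))\<^sup>2) = (\<Sum>k\<in>?B \<inter> range s12. (cmod (push s12 h k))\<^sup>2)"
      by (intro sum.mono_neutral_right) (auto simp: push_def)
    also have "\<dots> \<le> (\<Sum>k\<in>s12 ` ?B. (cmod (push s12 h k))\<^sup>2)"
      by (intro sum_mono2) auto
    also have "\<dots> = ?H"
      by (subst sum.reindex) (auto intro: inj_on_subset[OF inj_s12] simp: push_apply)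
    finally have P: "(\<Sum>k\<in>?B. (cmod (push s12 h k))\<^sup>2) \<le> ?H" .
    have Gb: "(\<Sum>k\<in>?B. (cmod (g k))\<^sup>2) \<le> G"
      unfolding G_def using g by (intro finite_sum_le_infsum) (auto simp: l2_def)
    have "?H \<le> (\<Sum>k\<in>?B. (cmod (g k))\<^sup>2) / (1 - a) + a * (\<Sum>k\<in>?B. (cmod (push s12 h k))\<^sup>2)"
      unfolding sum_divide_distrib sum_distrib_left sum.distrib[symmetric] by (intro sum_mono pt)
    also have "\<dots> \<le> G / (1 - a) + a * ?H"
      using P Gb a by (intro add_mono divide_right_mono mult_left_mono) auto
    finally have "(1 - a) * ?H \<le> G / (1 - a)" by (simp add: algebra_simps)
    then show ?thesis using a by (simp add: pos_le_divide_eq power2_eq_square mult_ac)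
  qed
  show "h \<in> l2" unfolding l2_def mem_Collect_eq
  proof (rule nonneg_bdd_above_summable_on)
    show "bdd_above (sum (\<lambda>k. (cmod (h k))\<^sup>2) ` {F. F \<subseteq> UNIV \<and> finite F})"
    proof (rule bdd_aboveI2)
      fix F :: "(nat \<times> nat) set" assume "F \<in> {F. F \<subseteq> UNIV \<and> finite F}"
      then have F: "finite F" by simp
      define N where "N = Suc (Max (fst ` F \<union> snd ` F))"
      have "F \<subseteq> {..<N} \<times> {..<N}"
      proof
        fix k assume "k \<in> F"
        then have "fst k \<le> Max (fst ` F \<union> snd ` F)" "snd k \<le> Max (fst ` F \<union> snd ` F)"
          using F by (auto intro!: Max_ge)
        then show "k \<in> {..<N} \<times> {..<N}" by (cases k) (auto simp: N_def)
      qed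
      then have "(\<Sum>k\<in>F. (cmod (h k))\<^sup>2) \<le> (\<Sum>k\<in>{..<N}\<times>{..<N}. (cmod (h k))\<^sup>2)"
        by (intro sum_mono2) auto
      then show "(\<Sum>k\<in>F. (cmod (h k))\<^sup>2) \<le> G / (1 - a)\<^sup>2" using box[of N] by simp
    qed
  qed auto
qed

lemma H2_coeffs_zw: "H2_coeffs f c \<Longrightarrow> H2_coeffs (\<lambda>p. fst p * snd p * f p) (push s12 c)"
  by (intro H2_coeffs_push inj_s12) (auto simp: mon_def s12_def)

lemma denom_nonzero:
  assumes "0 < a" "a < 1" "p \<in> bidisc"
  shows "1 - of_real a * fst p * snd p \<noteq> 0"
proof
  assume "1 - of_real a * fst p * snd p = 0"
  then have "of_real a * fst p * snd p = (1::complex)" by simp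
  then have "a * (cmod (fst p) * cmod (snd p)) = 1"
    using assms by (metis abs_of_pos mult.assoc norm_mult norm_of_real norm_one)
  moreover have "cmod (fst p) * cmod (snd p) \<le> 1"
    using assms(3) by (intro mult_le_one) (auto simp: bidisc_def)
  ultimately show False using assms
    by (smt (verit) mult_left_le)
qed

text \<open>Every \<open>g\<close> in the Hardy space is \<open>(1 - a z w) h\<close>, and then \<open>\<theta> g = (z w - a) h\<close>: in this form the
  coefficients of \<open>\<theta> g\<close> involve no power series expansion of \<open>\<theta>\<close>.\<close>

lemma theta_mult_coeffs:
  assumes a: "0 < a" "a < 1" and h: "h \<in> l2"
    and g: "g = H2_fun (\<lambda>k. h k - of_real a * push s12 h k)"
  shows "H2_coeffs (\<lambda>p. theta a p * g p) (\<lambda>k. push s12 h k - of_real a * h k)"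
proof -
  let ?H = "H2_fun h"
  note H = H2_coeffs_H2_fun[OF h]
  have den: "g p = ?H p - of_real a * (fst p * snd p * ?H p)" if "p \<in> bidisc" for p
  proof -
    have "H2_coeffs (\<lambda>p. ?H p - of_real a * (fst p * snd p * ?H p)) (\<lambda>k. h k - of_real a * push s12 h k)"
      by (intro H2_coeffs_diff H2_coeffs_scale H2_coeffs_zw H)
    then show ?thesis using that by (auto simp: g H2_fun_def H2_coeffs_iff infsumI)
  qed
  have num: "H2_coeffs (\<lambda>p. fst p * snd p * ?H p - of_real a * ?H p) (\<lambda>k. push s12 h k - of_real a * h k)"
    by (intro H2_coeffs_diff H2_coeffs_scale H2_coeffs_zw H)
  have "theta a p * g p = fst p * snd p * ?H p - of_real a * ?H p" if "p \<in> bidisc" for p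
  proof -
    have "g p = (1 - of_real a * fst p * snd p) * ?H p" using den[OF that] by (simp add: algebra_simps)
    then have "theta a p * g p = (fst p * snd p - of_real a) * ?H p"
      using denom_nonzero[OF a that] by (simp add: theta_def case_prod_unfold)
    then show ?thesis by (simp add: algebra_simps)
  qed
  with num show ?thesis by (simp add: H2_coeffs_iff)
qed

text \<open>Elements of \<open>Qseq a\<close> are orthogonal to \<open>\<theta> g\<close> by writing \<open>g = (1 - a z w) h\<close>. Conversely, testing
  against \<open>g = (1 - a z w) z\<^sup>m w\<^sup>n\<close>, for which \<open>\<theta> g = z\<^bsup>m+1\<^esup> w\<^bsup>n+1\<^esup> - a z\<^sup>m w\<^sup>n\<close>, gives the
  recursion at \<open>(m, n)\<close>.\<close>

lemma H2_ominus_theta: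
  assumes a: "0 < a" "a < 1"
  shows "H2_ominus (mult_H2 (theta a)) = H2_fun ` Qseq a"
proof (intro equalityI subsetI)
  fix f assume "f \<in> H2_fun ` Qseq a"
  then obtain c where c: "c \<in> Qseq a" "c \<in> l2" "f = H2_fun c" by (auto simp: Qseq_def)
  have "H2_inner f (\<lambda>p. theta a p * g p) = 0" if g: "g \<in> H2" for g
  proof -
    obtain d where d: "d \<in> l2" "g = H2_fun d" using g unfolding H2_eq_image by blast
    obtain h where h: "h \<in> l2" "\<And>k. h k - of_real a * push s12 h k = d k"
      using resolvent_exists[OF a d(1)] by blast
    have "H2_inner f (\<lambda>p. theta a p * g p) = l2_inner c (\<lambda>k. push s12 h k - of_real a * h k)"
      using c d h by (intro H2_inner_eq theta_mult_coeffs[OF a]) (auto simp: H2_coeffs_H2_fun)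
    also have "\<dots> = 0" using Qseq_orthogonal[OF h(1) c(1)] by (metis complex_cnj_zero l2_inner_cnj)
    finally show ?thesis .
  qed
  then show "f \<in> H2_ominus (mult_H2 (theta a))"
    using c by (auto simp: H2_ominus_def mult_H2_def H2_fun_in_H2)
next
  fix f assume f: "f \<in> H2_ominus (mult_H2 (theta a))"
  then obtain c where c: "c \<in> l2" "f = H2_fun c" by (auto simp: H2_ominus_def H2_eq_image)
  have "c (s12 k) = of_real a * c k" for k
  proof -
    define e where "e = (\<lambda>j. if j = k then 1 else (0::complex))"
    have e: "e \<in> l2" unfolding l2_def mem_Collect_eq
      by (subst summable_on_cong_neutral[where T = "{k}" and g = "\<lambda>_. 1"]) (auto simp: e_def)
    define g where "g = H2_fun (\<lambda>k. e k - of_real a * push s12 e k)"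
    have g: "g \<in> H2" unfolding g_def by (intro H2_fun_in_H2 l2_diff e l2_scale push_l2 inj_s12)
    have ipe: "l2_inner e d = cnj (d k)" for d
      unfolding l2_inner_def by (rule infsumI, subst has_sum_finite_neutralI[of "{k}"]) (auto simp: e_def)
    have "0 = H2_inner f (\<lambda>p. theta a p * g p)"
      using f g by (auto simp: H2_ominus_def mult_H2_def)
    also have "\<dots> = l2_inner c (\<lambda>k. push s12 e k - of_real a * e k)"
      using c by (intro H2_inner_eq theta_mult_coeffs[OF a e g_def]) (auto simp: H2_coeffs_H2_fun)
    also have "\<dots> = cnj (l2_inner (push s12 e) c) - of_real a * cnj (l2_inner e c)"
      using c e by (simp add: l2_inner_diff_right push_l2 inj_s12 l2_scale l2_inner_scale_right l2_inner_cnj)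
    also have "\<dots> = c (s12 k) - of_real a * c k"
      by (simp add: l2_inner_push inj_s12 ipe)
    finally show ?thesis by simp
  qed
  then show "f \<in> H2_fun ` Qseq a" using c by (auto simp: Qseq_def)
qed

text \<open>Closedness holds because each coefficient depends continuously on the function. Invariance
  holds because the adjoints are backward shifts, which commute with the backward diagonal shift.\<close>

lemma quotient_module_Qseq: "quotient_module (H2_fun ` Qseq a)"
proof -
  interpret H: Metric_space H2 H2_dist by (rule Metric_space_H2)
  have cl: "closedin H.mtopology (H2_fun ` Qseq a)"
    unfolding H.closedin_metric
  proof (intro conjI allI impI)
    show "H2_fun ` Qseq a \<subseteq> H2" using Qseq_l2[of a] by (auto simp: H2_fun_in_H2)
    fix f assume f: "f \<in> H2 - H2_fun ` Qseq a"
    then obtain c where c: "c \<in> l2" "f = H2_fun c" by (auto simp: H2_eq_image)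
    then have "c \<notin> Qseq a" using f by blast
    then obtain k where k: "c (s12 k) \<noteq> of_real a * c k" using c unfolding Qseq_def by blast
    \<comment> \<open>a function within \<open>r\<close> of \<open>f\<close> changes the defect of the recursion at \<open>k\<close> by less than the defect of \<open>f\<close>\<close>
    define r where "r = cmod (c (s12 k) - of_real a * c k) / (1 + \<bar>a\<bar>)"
    have "disjnt (H2_fun ` Qseq a) (H.mball f r)"
    proof (rule ccontr)
      assume "\<not> ?thesis"
      then obtain d where d: "d \<in> Qseq a" "H2_dist f (H2_fun d) < r"
        by (auto simp: disjnt_iff)
      have dl: "d \<in> l2" using d Qseq_l2 by auto
      let ?N = "l2_norm (\<lambda>k. c k - d k)"
      have N: "?N < r" using d c dl by (simp add: H2_dist_H2_fun)
      have b: "cmod (c j - d j) \<le> ?N" for j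
        using cmod_le_l2_norm[OF l2_diff[OF c(1) dl]] by simp
      have "c (s12 k) - of_real a * c k = (c (s12 k) - d (s12 k)) - of_real a * (c k - d k)"
        using Qseq_s12[OF d(1)] by (simp add: algebra_simps)
      then have "cmod (c (s12 k) - of_real a * c k) \<le> cmod (c (s12 k) - d (s12 k)) + \<bar>a\<bar> * cmod (c k - d k)"
        by (metis norm_mult norm_of_real norm_triangle_ineq4)
      also have "\<dots> \<le> ?N + \<bar>a\<bar> * ?N"
        using b by (intro add_mono mult_left_mono) auto
      also have "\<dots> = (1 + \<bar>a\<bar>) * ?N" by (simp add: algebra_simps)
      also have "\<dots> < (1 + \<bar>a\<bar>) * r" using N by (intro mult_strict_left_mono) auto
      finally show False by (simp add: r_def)
    qed
    moreover have "r > 0" using k by (simp add: r_def add_pos_nonneg)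
    ultimately show "\<exists>r>0. disjnt (H2_fun ` Qseq a) (H.mball f r)" by blast
  qed
  have zero: "(\<lambda>p. 0) = H2_fun (\<lambda>k. 0)" by (auto simp: H2_fun_def)
  have "H2_closed_subspace (H2_fun ` Qseq a)"
    unfolding H2_closed_subspace_def
  proof (intro conjI ballI allI cl)
    show "H2_fun ` Qseq a \<subseteq> H2" using Qseq_l2[of a] by (auto simp: H2_fun_in_H2)
    show "(\<lambda>p. 0) \<in> H2_fun ` Qseq a" unfolding zero by (auto simp: Qseq_def l2_zero)
    show "(\<lambda>p. f p + g p) \<in> H2_fun ` Qseq a" if "f \<in> H2_fun ` Qseq a" "g \<in> H2_fun ` Qseq a" for f g
      using that by (auto simp: Qseq_def H2_fun_add l2_add algebra_simps)
    show "(\<lambda>p. \<alpha> * f p) \<in> H2_fun ` Qseq a" if "f \<in> H2_fun ` Qseq a" for f \<alpha>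
      using that by (auto simp: Qseq_def H2_fun_scale l2_scale algebra_simps)
  qed
  moreover have "H2_adjoint H2 M1 f \<in> H2_fun ` Qseq a" "H2_adjoint H2 M2 f \<in> H2_fun ` Qseq a"
    if "f \<in> H2_fun ` Qseq a" for f
    using that by (auto simp: Qseq_def H2_adjoint_M1 H2_adjoint_M2 pull_l2[OF inj_s1] pull_l2[OF inj_s2])
  ultimately show ?thesis by (simp add: quotient_module_def)
qed

section \<open>The compressed shifts\<close>

text \<open>On the diagonals with \<open>m > n\<close> the array \<open>c (m - 1, n)\<close> of \<open>z f\<close> is already geometric. On the others
  the coefficients of \<open>z f\<close> start with \<open>0\<close> on the boundary, and projecting the sequence
  \<open>0, 1, a, a\<^sup>2, \<dots>\<close> onto the geometric sequences yields \<open>a, a\<^sup>2, a\<^sup>3, \<dots>\<close>. At \<open>(m, n)\<close> this is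
  \<open>a c (m, n + 1)\<close>.\<close>

definition shift1_Q :: "real \<Rightarrow> (nat \<times> nat \<Rightarrow> complex) \<Rightarrow> nat \<times> nat \<Rightarrow> complex" where
  "shift1_Q a c = (\<lambda>(m, n). if m > n then c (m - 1, n) else of_real a * c (m, Suc n))"

definition shift2_Q :: "real \<Rightarrow> (nat \<times> nat \<Rightarrow> complex) \<Rightarrow> nat \<times> nat \<Rightarrow> complex" where
  "shift2_Q a c = (\<lambda>(m, n). if n > m then c (m, n - 1) else of_real a * c (Suc m, n))"

text \<open>The projection onto \<open>Q\<close> is found by exhibiting the defect as \<open>S h - a h\<close>, the coefficients of a
  multiple of \<open>\<theta>\<close>.\<close>

lemma projection_by_theta_multiple:
  assumes c: "c \<in> l2" and h: "h \<in> l2"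
    and d: "\<And>k. c k - d k = push s12 h k - of_real a * h k"
    and rec: "\<And>k. d (s12 k) = of_real a * d k"
  shows "d \<in> Qseq a" "H2_proj (H2_fun ` Qseq a) (H2_fun c) = H2_fun d"
proof -
  have "d = (\<lambda>k. c k - (push s12 h k - of_real a * h k))" using d by (auto simp: fun_eq_iff algebra_simps)
  also have "\<dots> \<in> l2" by (intro l2_diff c h l2_scale push_l2 inj_s12)
  finally show dQ: "d \<in> Qseq a" unfolding Qseq_def using rec by blast
  show "H2_proj (H2_fun ` Qseq a) (H2_fun c) = H2_fun d"
    by (rule H2_proj_eqI[OF refl Qseq_l2 Qseq_diff c dQ]) (simp_all add: d Qseq_orthogonal h)
qed

text \<open>The defect \<open>z f - Q\<^sub>1 f\<close> lives on the diagonals with \<open>m \<le> n\<close>, where it equals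
  \<open>c (m - 1, n) - a c (m, n + 1)\<close>, with \<open>c (-1, n)\<close> read as \<open>0\<close>. This has the form \<open>S h - a h\<close> for
  \<open>h (m, n) = c (m, n + 1)\<close>.\<close>

lemma compression_M1:
  assumes c: "c \<in> Qseq a"
  shows "shift1_Q a c \<in> Qseq a" "compression (H2_fun ` Qseq a) M1 (H2_fun c) = H2_fun (shift1_Q a c)"
proof -
  have cl: "c \<in> l2" using c Qseq_l2 by auto
  define h where "h = (\<lambda>k. if fst k \<le> snd k then c (s2 k) else 0)"
  have h: "h \<in> l2" unfolding h_def by (intro l2_restrict pull_l2[OF inj_s2 cl])
  have d: "push s1 c k - shift1_Q a c k = push s12 h k - of_real a * h k" for k
    by (cases k) (auto simp: push_s1 push_s12 shift1_Q_def h_def split: nat.splits)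
  have r: "shift1_Q a c (s12 k) = of_real a * shift1_Q a c k" for k
    by (cases k; cases "fst k") (auto simp: shift1_Q_def Qseq_Suc[OF c])
  show "shift1_Q a c \<in> Qseq a" "compression (H2_fun ` Qseq a) M1 (H2_fun c) = H2_fun (shift1_Q a c)"
    using projection_by_theta_multiple[OF push_l2[OF inj_s1 cl] h d r]
    by (simp_all add: compression_def M1_H2_fun cl)
qed

lemma compression_M2:
  assumes c: "c \<in> Qseq a"
  shows "shift2_Q a c \<in> Qseq a" "compression (H2_fun ` Qseq a) M2 (H2_fun c) = H2_fun (shift2_Q a c)"
    "\<And>d. d \<in> Qseq a \<Longrightarrow> l2_inner (shift2_Q a c) d = l2_inner c (\<lambda>k. d (s2 k))"
proof -
  have cl: "c \<in> l2" using c Qseq_l2 by auto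
  define h where "h = (\<lambda>k. if snd k \<le> fst k then c (s1 k) else 0)"
  have h: "h \<in> l2" unfolding h_def by (intro l2_restrict pull_l2[OF inj_s1 cl])
  have d: "push s2 c k - shift2_Q a c k = push s12 h k - of_real a * h k" for k
    by (cases k) (auto simp: push_s2 push_s12 shift2_Q_def h_def split: nat.splits)
  have r: "shift2_Q a c (s12 k) = of_real a * shift2_Q a c k" for k
    by (cases k; cases "snd k") (auto simp: shift2_Q_def Qseq_Suc[OF c])
  show q: "shift2_Q a c \<in> Qseq a" "compression (H2_fun ` Qseq a) M2 (H2_fun c) = H2_fun (shift2_Q a c)"
    using projection_by_theta_multiple[OF push_l2[OF inj_s2 cl] h d r]
    by (simp_all add: compression_def M2_H2_fun cl)
  show "l2_inner (shift2_Q a c) e = l2_inner c (\<lambda>k. e (s2 k))" if e: "e \<in> Qseq a" for e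
  proof -
    have l: "shift2_Q a c \<in> l2" "e \<in> l2" using q e Qseq_l2 by auto
    have "l2_inner (push s2 c) e - l2_inner (shift2_Q a c) e = l2_inner (\<lambda>k. push s12 h k - of_real a * h k) e"
      using l cl by (simp add: l2_inner_diff_left[symmetric] push_l2 inj_s2 d)
    also have "\<dots> = 0" by (rule Qseq_orthogonal[OF h e])
    finally show ?thesis by (simp add: l2_inner_push inj_s2)
  qed
qed

text \<open>\<open>Q\<close> is invariant under \<open>M\<^sub>2\<^sup>*\<close>, so the adjoint of the compression is the restriction of \<open>M\<^sub>2\<^sup>*\<close>.\<close>

lemma adjoint_compression_M2:
  assumes c: "c \<in> Qseq a"
  shows "(\<lambda>k. c (s2 k)) \<in> Qseq a"
    "H2_adjoint (H2_fun ` Qseq a) (compression (H2_fun ` Qseq a) M2) (H2_fun c) = H2_fun (\<lambda>k. c (s2 k))"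
proof -
  show b: "(\<lambda>k. c (s2 k)) \<in> Qseq a" using c by (auto simp: Qseq_def pull_l2[OF inj_s2])
  have "H2_inner (compression (H2_fun ` Qseq a) M2 (H2_fun d)) (H2_fun c) = l2_inner d (\<lambda>k. c (s2 k))"
    if d: "d \<in> Qseq a" for d
    using compression_M2[OF d] c Qseq_l2[of a] by (simp add: H2_inner_H2_fun subset_iff)
  then show "H2_adjoint (H2_fun ` Qseq a) (compression (H2_fun ` Qseq a) M2) (H2_fun c) = H2_fun (\<lambda>k. c (s2 k))"
    by (intro H2_adjoint_eqI[OF refl Qseq_l2 Qseq_diff b])
qed

text \<open>With \<open>c\<close> in \<open>Qseq a\<close>, both sides have the entry \<open>a\<^sup>2 c (m - 1, n)\<close> at \<open>(m, n)\<close> when \<open>m > n\<close>, and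
  \<open>a c (m, n + 1)\<close> when \<open>m \<le> n\<close>.\<close>

lemma phi_doubly_commuting_Qseq: "phi_doubly_commuting (H2_fun ` Qseq a)"
proof -
  have "shift1_Q a (shift2_Q a (\<lambda>k. c (s2 k))) = (\<lambda>k. shift1_Q a (shift2_Q a c) (s2 k))" if c: "c \<in> Qseq a" for c
  proof
    fix k :: "nat \<times> nat"
    obtain m n where k: "k = (m, n)" by (cases k)
    show "shift1_Q a (shift2_Q a (\<lambda>k. c (s2 k))) k = shift1_Q a (shift2_Q a c) (s2 k)"
      by (cases m) (auto simp: k shift1_Q_def shift2_Q_def Qseq_Suc[OF c])
  qed
  then show ?thesis
    by (auto simp: phi_doubly_commuting_def Let_def adjoint_compression_M2 compression_M1 compression_M2)
qed

theorem proposition3p16: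
  fixes a :: real
  assumes "0 < a" and "a < 1"
  shows "quotient_module (H2_ominus (mult_H2 (theta a))) \<and>
         phi_doubly_commuting (H2_ominus (mult_H2 (theta a)))"
  unfolding H2_ominus_theta[OF assms]
  using quotient_module_Qseq phi_doubly_commuting_Qseq by blast

end
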